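(* Let $\varepsilon\in(0,1)$. Then there exist infinitely many graphs $G=(V,E)$ and sets $X=\{x_1,\dots,x_k\}$ of personalized PageRanks on $G$ (i.e. each $x_i=\mathrm{PR}(G,c_i,\varepsilon)$ for some $c_i\in V$), so that $x_1,\dots,x_k\in\mathcal{P}_\varepsilon(G)$, such that $\|\mathrm{median}\{x_1,\dots,x_k\}\|_1>0$ but $R_{\mathrm{med}}(G,X)\notin\mathcal{P}_\varepsilon(G)$. Moreover, $R_{\mathrm{med}}(G,X)\notin\mathcal{P}_\eta(G)$ for any $\eta\le1/2$.
   Context: Graphs are finite directed graphs; vertices with no out-edges carry a self-loop. A ranking (reset) vector is $x:V\to[0,1]$ with $\sum_v x[v]=1$. $\mathrm{PR}(G,r,\varepsilon)$ is the unique stationary distribution of the chain with transition matrix $(1-\varepsilon)M+\varepsilon R$, $M[u,v]=1/d_{out}(u)$ for $(u,v)\in E$ (else 0), $R[u,v]=r[v]$; $\mathrm{PR}(G,c,\varepsilon)$ uses the point mass at $c$. $\mathcal{P}_\eta(G)=\{\mathrm{PR}(G,r,\eta): r\text{ a ranking vector}\}$. The median of vectors is taken component-wise, and for $X=\{x_1,\dots,x_k\}$ with $\|\mathrm{median}\{x_i\}\|_1>0$, $R_{\mathrm{med}}(G,X)=\mathrm{median}\{x_i\}/\|\mathrm{median}\{x_i\}\|_1$. *)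

theory Defs
  imports Complex_Main "HOL-Library.Multiset"
    "Graph_Theory.Pair_Digraph" "Graph_Theory.Digraph_Isomorphism"
begin

text \<open>Since would-be sinks carry a self-loop, every vertex has an out-edge. Other loops are
  not excluded.\<close>

definition pr_graph :: "'a pair_pre_digraph \<Rightarrow> bool" where
  "pr_graph G \<longleftrightarrow> pair_fin_digraph G \<and> (\<forall>u\<in>pverts G. \<exists>v\<in>pverts G. (u, v) \<in> parcs G)"

text \<open>Vectors indexed by the vertex set are functions that vanish outside it, so that equality
  of functions is equality of vectors.\<close>

definition ranking_vector :: "'a pair_pre_digraph \<Rightarrow> ('a \<Rightarrow> real) \<Rightarrow> bool" where
  "ranking_vector G x \<longleftrightarrow>
     (\<forall>v\<in>pverts G. 0 \<le> x v \<and> x v \<le> 1) \<and> (\<forall>v. v \<notin> pverts G \<longrightarrow> x v = 0) \<and>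
     (\<Sum>v\<in>pverts G. x v) = 1"

definition walk_matrix :: "'a pair_pre_digraph \<Rightarrow> 'a \<Rightarrow> 'a \<Rightarrow> real" where
  "walk_matrix G u v = (if (u, v) \<in> parcs G then 1 / real (out_degree (with_proj G) u) else 0)"

definition pr_matrix :: "'a pair_pre_digraph \<Rightarrow> ('a \<Rightarrow> real) \<Rightarrow> real \<Rightarrow> 'a \<Rightarrow> 'a \<Rightarrow> real" where
  "pr_matrix G r \<epsilon> u v = (1 - \<epsilon>) * walk_matrix G u v + \<epsilon> * r v"

definition stationary_distribution ::
    "'a pair_pre_digraph \<Rightarrow> ('a \<Rightarrow> 'a \<Rightarrow> real) \<Rightarrow> ('a \<Rightarrow> real) \<Rightarrow> bool" where
  "stationary_distribution G P x \<longleftrightarrow>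
     ranking_vector G x \<and> (\<forall>v\<in>pverts G. (\<Sum>u\<in>pverts G. x u * P u v) = x v)"

text \<open>The description is proper (existence and uniqueness) for a graph as above, a ranking
  vector \<open>r\<close> and \<open>0 < \<epsilon> \<le> 1\<close>; it is only meant to be used there.\<close>

definition PR :: "'a pair_pre_digraph \<Rightarrow> ('a \<Rightarrow> real) \<Rightarrow> real \<Rightarrow> 'a \<Rightarrow> real" where
  "PR G r \<epsilon> = (THE x. stationary_distribution G (pr_matrix G r \<epsilon>) x)"

definition point_mass :: "'a \<Rightarrow> 'a \<Rightarrow> real" where
  "point_mass c v = (if v = c then 1 else 0)"

definition personalized_PR :: "'a pair_pre_digraph \<Rightarrow> 'a \<Rightarrow> real \<Rightarrow> 'a \<Rightarrow> real" where
  "personalized_PR G c \<epsilon> = PR G (point_mass c) \<epsilon>"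

definition PR_set :: "'a pair_pre_digraph \<Rightarrow> real \<Rightarrow> ('a \<Rightarrow> real) set" where
  "PR_set G \<eta> = {PR G r \<eta> | r. ranking_vector G r}"

text \<open>For an even number of values the median is the mean of the two middle ones; for an odd
  number the two indices coincide.\<close>

definition median :: "real multiset \<Rightarrow> real" where
  "median A = (let xs = sorted_list_of_multiset A; n = size A
               in (xs ! ((n - 1) div 2) + xs ! (n div 2)) / 2)"

text \<open>The vectors in \<open>X\<close> are distinct, but their entries at a vertex are counted with
  multiplicity.\<close>

definition median_vec :: "('a \<Rightarrow> real) set \<Rightarrow> 'a \<Rightarrow> real" where
  "median_vec X v = median (image_mset (\<lambda>x. x v) (mset_set X))"

definition l1_norm :: "'a pair_pre_digraph \<Rightarrow> ('a \<Rightarrow> real) \<Rightarrow> real" where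
  "l1_norm G x = (\<Sum>v\<in>pverts G. \<bar>x v\<bar>)"

definition R_med :: "'a pair_pre_digraph \<Rightarrow> ('a \<Rightarrow> real) set \<Rightarrow> 'a \<Rightarrow> real" where
  "R_med G X v = median_vec X v / l1_norm G (median_vec X)"

end

theory Submission
  imports Defs
begin

text \<open>A stationary distribution \<open>x\<close> for \<open>(1 - \<eta>) M + \<eta> R\<close> satisfies
  \<open>x[v] \<ge> (1 - \<eta>) (x M)[v]\<close> at every vertex. Medians can violate this because the median of a
  sum may be half of the sum of the medians: let \<open>c\<^sub>1 \<rightarrow> u\<^sub>1, u\<^sub>2\<close>, let \<open>c\<^sub>2 \<rightarrow> u\<^sub>1, s\<close> and
  \<open>c\<^sub>3 \<rightarrow> u\<^sub>2, s\<close>, let \<open>u\<^sub>1, u\<^sub>2 \<rightarrow> v \<rightarrow> s\<close>, where \<open>s\<close> is a sink. For the PageRanks personalized at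
  \<open>c\<^sub>1, c\<^sub>2, c\<^sub>3\<close>, with \<open>a = \<epsilon> (1 - \<epsilon>) / 2\<close>, the entries at \<open>u\<^sub>1\<close> are \<open>a, a, 0\<close>, those at \<open>u\<^sub>2\<close> are
  \<open>a, 0, a\<close> and those at \<open>v\<close> are \<open>2 (1 - \<epsilon>) a, (1 - \<epsilon>) a, (1 - \<epsilon>) a\<close>. The medians are \<open>a\<close>, \<open>a\<close> and
  \<open>(1 - \<epsilon>) a\<close>, so membership in \<open>\<P>\<^sub>\<eta>(G)\<close> would force \<open>(1 - \<epsilon>) a \<ge> 2 (1 - \<eta>) a\<close>, which fails for
  \<open>\<eta> = \<epsilon>\<close> and for \<open>\<eta> \<le> 1/2\<close>. Further vertices pointing to \<open>s\<close> make the family infinite.\<close>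

section \<open>Existence and uniqueness of PageRank\<close>

lemma walk_matrix_nonneg: "0 \<le> walk_matrix G u v"
  by (simp add: walk_matrix_def)

lemma finite_pverts_pr_graph: "pr_graph G \<Longrightarrow> finite (pverts G)"
  unfolding pr_graph_def by (auto dest: pair_fin_digraph.pair_finite_verts)

lemma out_degree_with_proj: "out_degree (with_proj G) u = card {v. (u, v) \<in> parcs G}"
proof -
  have "out_arcs (with_proj G) u = Pair u ` {v. (u, v) \<in> parcs G}"
    by (auto simp: out_arcs_def)
  then show ?thesis
    by (simp add: out_degree_def card_image inj_on_def)
qed

lemma walk_matrix_row_sum:
  assumes G: "pr_graph G" and u: "u \<in> pverts G"
  shows "(\<Sum>v\<in>pverts G. walk_matrix G u v) = 1"
proof -
  interpret pair_fin_digraph G using G by (simp add: pr_graph_def)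
  let ?N = "{v. (u, v) \<in> parcs G}"
  have sub: "?N \<subseteq> pverts G" using in_arcsD2 by blast
  then have fin: "finite ?N" using finite_subset pair_finite_verts by blast
  have "(\<Sum>v\<in>pverts G. walk_matrix G u v) = (\<Sum>v\<in>?N. 1 / real (card ?N))"
    using sub pair_finite_verts
    by (intro sum.mono_neutral_cong_right) (auto simp: walk_matrix_def out_degree_with_proj)
  moreover have "?N \<noteq> {}" using G u by (auto simp: pr_graph_def)
  ultimately show ?thesis using fin by simp
qed

lemma ranking_vector_nonneg: "ranking_vector G x \<Longrightarrow> 0 \<le> x v"
  unfolding ranking_vector_def by (cases "v \<in> pverts G") auto

lemma ranking_vectorI:
  assumes "finite (pverts G)" "\<And>v. v \<in> pverts G \<Longrightarrow> 0 \<le> x v" "\<And>v. v \<notin> pverts G \<Longrightarrow> x v = 0"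
    "(\<Sum>v\<in>pverts G. x v) = 1"
  shows "ranking_vector G x"
proof -
  have "x v \<le> 1" if "v \<in> pverts G" for v
    using member_le_sum[of v "pverts G" x] assms that by auto
  then show ?thesis using assms by (auto simp: ranking_vector_def)
qed

text \<open>The entries of \<open>x\<close> sum to 1, so the reset part contributes
  \<open>\<eta> * r v\<close> whatever \<open>x\<close> is. Stationarity thereby becomes an affine
  equation in \<open>x\<close>.\<close>

lemma sum_pr_matrix:
  assumes "ranking_vector G x"
  shows "(\<Sum>u\<in>pverts G. x u * pr_matrix G r \<eta> u v) =
    (1 - \<eta>) * (\<Sum>u\<in>pverts G. x u * walk_matrix G u v) + \<eta> * r v"
proof -
  have "(\<Sum>u\<in>pverts G. x u * pr_matrix G r \<eta> u v) =
    (\<Sum>u\<in>pverts G. (1 - \<eta>) * (x u * walk_matrix G u v) + \<eta> * r v * x u)"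
    by (intro sum.cong) (auto simp: pr_matrix_def algebra_simps)
  also have "\<dots> = (1 - \<eta>) * (\<Sum>u\<in>pverts G. x u * walk_matrix G u v) + \<eta> * r v * (\<Sum>u\<in>pverts G. x u)"
    by (simp add: sum.distrib sum_distrib_left)
  finally show ?thesis using assms by (simp add: ranking_vector_def)
qed

lemma stationary_distribution_pr_matrix_iff:
  "stationary_distribution G (pr_matrix G r \<eta>) x \<longleftrightarrow> ranking_vector G x \<and>
    (\<forall>v\<in>pverts G. x v = (1 - \<eta>) * (\<Sum>u\<in>pverts G. x u * walk_matrix G u v) + \<eta> * r v)"
  unfolding stationary_distribution_def using sum_pr_matrix[of G x r \<eta>] by auto

text \<open>The reset term cancels in the difference of two solutions. As the rows of
  \<open>walk_matrix\<close> sum to 1, the l1 norm of the difference is at most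
  \<open>1 - \<eta>\<close> times itself, hence zero.\<close>

lemma stationary_distribution_unique:
  assumes G: "pr_graph G" and \<eta>: "0 < \<eta>" "\<eta> \<le> 1"
    and x: "stationary_distribution G (pr_matrix G r \<eta>) x"
    and y: "stationary_distribution G (pr_matrix G r \<eta>) y"
  shows "x = y"
proof -
  let ?V = "pverts G" and ?M = "walk_matrix G"
  let ?d = "\<lambda>v. \<bar>x v - y v\<bar>"
  have "?d v \<le> (1 - \<eta>) * (\<Sum>u\<in>?V. ?d u * ?M u v)" if v: "v \<in> ?V" for v
  proof -
    have *: "z v - (1 - \<eta>) * (\<Sum>u\<in>?V. z u * ?M u v) = \<eta> * r v"
      if "stationary_distribution G (pr_matrix G r \<eta>) z" for z
    proof -
      have "z v = (1 - \<eta>) * (\<Sum>u\<in>?V. z u * ?M u v) + \<eta> * r v"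
        using that v unfolding stationary_distribution_pr_matrix_iff by blast
      then show ?thesis by linarith
    qed
    have "x v - y v = (1 - \<eta>) * (\<Sum>u\<in>?V. x u * ?M u v) - (1 - \<eta>) * (\<Sum>u\<in>?V. y u * ?M u v)"
      using *[OF x] *[OF y] by linarith
    also have "\<dots> = (1 - \<eta>) * (\<Sum>u\<in>?V. (x u - y u) * ?M u v)"
      by (simp add: left_diff_distrib sum_subtractf right_diff_distrib)
    finally have "x v - y v = (1 - \<eta>) * (\<Sum>u\<in>?V. (x u - y u) * ?M u v)" .
    then have "?d v = (1 - \<eta>) * \<bar>\<Sum>u\<in>?V. (x u - y u) * ?M u v\<bar>"
      using \<eta> by (simp add: abs_mult)
    also have "\<dots> \<le> (1 - \<eta>) * (\<Sum>u\<in>?V. \<bar>(x u - y u) * ?M u v\<bar>)"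
      using \<eta> by (intro mult_left_mono sum_abs) auto
    finally show ?thesis by (simp add: abs_mult walk_matrix_nonneg)
  qed
  then have "(\<Sum>v\<in>?V. ?d v) \<le> (\<Sum>v\<in>?V. (1 - \<eta>) * (\<Sum>u\<in>?V. ?d u * ?M u v))"
    by (rule sum_mono)
  also have "\<dots> = (1 - \<eta>) * (\<Sum>u\<in>?V. ?d u * (\<Sum>v\<in>?V. ?M u v))"
    unfolding sum_distrib_left by (rule sum.swap)
  also have "\<dots> = (1 - \<eta>) * (\<Sum>u\<in>?V. ?d u)"
    using walk_matrix_row_sum[OF G] by simp
  finally have "\<eta> * (\<Sum>v\<in>?V. ?d v) \<le> 0" by (simp add: algebra_simps)
  then have "(\<Sum>v\<in>?V. ?d v) \<le> 0" using \<eta> by (simp add: mult_le_0_iff)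
  moreover have "0 \<le> (\<Sum>v\<in>?V. ?d v)" by (simp add: sum_nonneg)
  ultimately have "\<forall>v\<in>?V. x v = y v"
    using finite_pverts_pr_graph[OF G] by (simp add: sum_nonneg_eq_0_iff order_antisym)
  \<comment> \<open>Off the vertex set both vectors vanish by convention, so they agree as
    functions.\<close>
  then show ?thesis
    using x y by (intro ext) (auto simp: stationary_distribution_def ranking_vector_def)
qed

text \<open>The distribution after \<open>n\<close> steps of the walk without resets, started from
  \<open>r\<close>.\<close>

fun walk_dist :: "'a pair_pre_digraph \<Rightarrow> ('a \<Rightarrow> real) \<Rightarrow> nat \<Rightarrow> 'a \<Rightarrow> real" where
  "walk_dist G r 0 v = r v"
| "walk_dist G r (Suc n) v =
    (if v \<in> pverts G then \<Sum>u\<in>pverts G. walk_dist G r n u * walk_matrix G u v else 0)"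

lemma ranking_vector_walk_dist:
  assumes G: "pr_graph G" and r: "ranking_vector G r"
  shows "ranking_vector G (walk_dist G r n)"
proof (induction n)
  case 0
  have "walk_dist G r 0 = r" by auto
  then show ?case using r by simp
next
  case (Suc n)
  let ?V = "pverts G"
  have "(\<Sum>v\<in>?V. walk_dist G r (Suc n) v) =
      (\<Sum>u\<in>?V. walk_dist G r n u * (\<Sum>v\<in>?V. walk_matrix G u v))"
    by (simp add: sum_distrib_left) (rule sum.swap)
  also have "\<dots> = 1"
    using Suc walk_matrix_row_sum[OF G] by (simp add: ranking_vector_def)
  finally show ?case
    using Suc finite_pverts_pr_graph[OF G]
    by (intro ranking_vectorI)
       (auto intro!: sum_nonneg mult_nonneg_nonneg simp: walk_matrix_nonneg ranking_vector_nonneg)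
qed

text \<open>The solution is a Neumann series: the law of the reset-free walk stopped after a
  geometrically distributed number of steps.\<close>

lemma stationary_distribution_exists:
  assumes G: "pr_graph G" and r: "ranking_vector G r" and \<eta>: "0 < \<eta>" "\<eta> \<le> 1"
  shows "\<exists>x. stationary_distribution G (pr_matrix G r \<eta>) x"
proof -
  let ?V = "pverts G" and ?M = "walk_matrix G" and ?p = "walk_dist G r"
  define t where "t n v = (1 - \<eta>) ^ n * ?p n v" for n v
  define x where "x v = \<eta> * (\<Sum>n. t n v)" for v
  note p = ranking_vector_walk_dist[OF G r]
  have t0: "0 \<le> t n v" for n v
    using \<eta> ranking_vector_nonneg[OF p] by (simp add: t_def)
  have geo: "(\<lambda>n. (1 - \<eta>) ^ n) sums (1 / \<eta>)"
    using geometric_sums[of "1 - \<eta>"] \<eta> by simp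
  have p1: "?p n v \<le> 1" for n v
    using p[of n] by (cases "v \<in> ?V") (auto simp: ranking_vector_def)
  have t: "summable (\<lambda>n. t n v)" for v
  proof (rule summable_comparison_test'[OF sums_summable[OF geo]])
    show "norm (t n v) \<le> (1 - \<eta>) ^ n" for n
      using t0[of n v] p1[of n v] \<eta> by (simp add: t_def mult_left_le)
  qed
  have "(\<Sum>v\<in>?V. x v) = \<eta> * (\<Sum>n. \<Sum>v\<in>?V. t n v)"
    unfolding x_def sum_distrib_left[symmetric] using t by (simp add: suminf_sum)
  also have "(\<lambda>n. \<Sum>v\<in>?V. t n v) = (\<lambda>n. (1 - \<eta>) ^ n)"
    using p by (simp add: t_def sum_distrib_left[symmetric] ranking_vector_def)
  finally have "(\<Sum>v\<in>?V. x v) = 1"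
    using sums_unique[OF geo, symmetric] \<eta> by simp
  then have rv: "ranking_vector G x"
    using finite_pverts_pr_graph[OF G] \<eta> t t0 p
    by (intro ranking_vectorI) (auto simp: x_def t_def suminf_nonneg ranking_vector_def)
  have "x v = (1 - \<eta>) * (\<Sum>u\<in>?V. x u * ?M u v) + \<eta> * r v" if v: "v \<in> ?V" for v
  proof -
    have "(\<Sum>u\<in>?V. x u * ?M u v) = \<eta> * (\<Sum>u\<in>?V. \<Sum>n. t n u * ?M u v)"
      unfolding x_def sum_distrib_left using t by (simp add: suminf_mult2 mult.assoc)
    also have "(\<Sum>u\<in>?V. \<Sum>n. t n u * ?M u v) = (\<Sum>n. \<Sum>u\<in>?V. t n u * ?M u v)"
      using t by (intro suminf_sum[symmetric] summable_mult2)
    finally have "(1 - \<eta>) * (\<Sum>u\<in>?V. x u * ?M u v) =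
        \<eta> * ((1 - \<eta>) * (\<Sum>n. \<Sum>u\<in>?V. t n u * ?M u v))" by simp
    \<comment> \<open>Applying \<open>(1 - \<eta>) * ?M\<close> to the term of index
      \<open>n\<close> gives the one of index \<open>Suc n\<close>, so the series loses only its
      first term, \<open>r v\<close>.\<close>
    also have "(1 - \<eta>) * (\<Sum>n. \<Sum>u\<in>?V. t n u * ?M u v) = (\<Sum>n. t (Suc n) v)"
      using t v by (subst suminf_mult[symmetric])
        (auto intro!: summable_sum summable_mult2 simp: t_def sum_distrib_left mult_ac)
    also have "\<dots> = (\<Sum>n. t n v) - r v"
      using suminf_split_head[OF t] by (simp add: t_def)
    finally show ?thesis by (simp add: x_def algebra_simps)
  qed
  with rv show ?thesis unfolding stationary_distribution_pr_matrix_iff by blast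
qed

lemma PR_eqI:
  assumes "pr_graph G" "0 < \<eta>" "\<eta> \<le> 1" "stationary_distribution G (pr_matrix G r \<eta>) x"
  shows "PR G r \<eta> = x"
  unfolding PR_def using assms by (intro the_equality) (auto intro: stationary_distribution_unique)

lemma stationary_distribution_PR:
  assumes "pr_graph G" "ranking_vector G r" "0 < \<eta>" "\<eta> \<le> 1"
  shows "stationary_distribution G (pr_matrix G r \<eta>) (PR G r \<eta>)"
  using stationary_distribution_exists[OF assms] PR_eqI assms by metis

text \<open>All terms of the stationarity equation are nonnegative, so dropping the reset and the
  predecessors outside \<open>U\<close> only decreases its right-hand side. This is the necessary
  condition that the medians violate.\<close>

lemma PR_set_lower_bound:
  assumes G: "pr_graph G" and \<eta>: "0 < \<eta>" "\<eta> \<le> 1" and x: "x \<in> PR_set G \<eta>"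
    and v: "v \<in> pverts G" and U: "U \<subseteq> pverts G"
  shows "(1 - \<eta>) * (\<Sum>u\<in>U. x u * walk_matrix G u v) \<le> x v"
proof -
  obtain r where r: "ranking_vector G r" and xr: "x = PR G r \<eta>"
    using x by (auto simp: PR_set_def)
  have st: "stationary_distribution G (pr_matrix G r \<eta>) x"
    using stationary_distribution_PR[OF G r \<eta>] by (simp add: xr)
  then have "ranking_vector G x" by (simp add: stationary_distribution_def)
  then have "(\<Sum>u\<in>U. x u * walk_matrix G u v) \<le> (\<Sum>u\<in>pverts G. x u * walk_matrix G u v)"
    using U finite_pverts_pr_graph[OF G]
    by (intro sum_mono2) (auto simp: walk_matrix_nonneg ranking_vector_nonneg)
  then have "(1 - \<eta>) * (\<Sum>u\<in>U. x u * walk_matrix G u v)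
      \<le> (1 - \<eta>) * (\<Sum>u\<in>pverts G. x u * walk_matrix G u v)"
    using \<eta> by (intro mult_left_mono) auto
  also have "\<dots> = x v - \<eta> * r v"
  proof -
    have "x v = (1 - \<eta>) * (\<Sum>u\<in>pverts G. x u * walk_matrix G u v) + \<eta> * r v"
      using st v unfolding stationary_distribution_pr_matrix_iff by blast
    then show ?thesis by linarith
  qed
  also have "\<dots> \<le> x v"
    using \<eta> ranking_vector_nonneg[OF r, of v] by simp
  finally show ?thesis .
qed

lemma ranking_vector_point_mass:
  assumes "finite (pverts G)" "c \<in> pverts G"
  shows "ranking_vector G (point_mass c)"
  using assms by (auto simp: ranking_vector_def point_mass_def)

section \<open>The counterexamples\<close>

lemma median_three:
  assumes "a \<le> b" "b \<le> c"
  shows "median {#a, b, c#} = b"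
proof -
  have "sorted_list_of_multiset {#a, b, c#} = sort [a, b, c]"
    by (metis mset.simps sorted_list_of_multiset_mset)
  also have "\<dots> = [a, b, c]" using assms by (intro sorted_sort_id) simp
  finally show ?thesis by (simp add: median_def)
qed

text \<open>Equal vectors would collapse in the set, which is why distinctness is assumed.\<close>

lemma median_vec_three:
  assumes "x \<noteq> y" "x \<noteq> z" "y \<noteq> z"
  shows "median_vec {x, y, z} v = median {#x v, y v, z v#}"
  using assms by (simp add: median_vec_def)

text \<open>The vertices \<open>0, \<dots>, 6\<close> are \<open>c\<^sub>1, c\<^sub>2, c\<^sub>3, u\<^sub>1, u\<^sub>2, v, s\<close>.\<close>

definition med_graph :: "nat \<Rightarrow> nat pair_pre_digraph" where
  "med_graph n = \<lparr>pverts = {..<7 + n},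
     parcs = {(0,3), (0,4), (1,3), (1,6), (2,4), (2,6), (3,5), (4,5)} \<union> {5..<7 + n} \<times> {6}\<rparr>"

lemma pverts_med_graph [simp]: "pverts (med_graph n) = {..<7 + n}"
  by (simp add: med_graph_def)

lemma pr_graph_med_graph: "pr_graph (med_graph n)"
  unfolding pr_graph_def
proof
  show "pair_fin_digraph (med_graph n)"
    by unfold_locales (auto simp: med_graph_def)
  show "\<forall>u\<in>pverts (med_graph n). \<exists>v\<in>pverts (med_graph n). (u, v) \<in> parcs (med_graph n)"
  proof
    fix u assume u: "u \<in> pverts (med_graph n)"
    \<comment> \<open>The last case covers \<open>v\<close>, the sink with its loop
      \<open>(6,6)\<close>, and all the additional vertices: each points to 6.\<close>
    then consider "u = 0" | "u = 1" | "u = 2" | "u = 3" | "u = 4" | "5 \<le> u" by linarith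
    then show "\<exists>v\<in>pverts (med_graph n). (u, v) \<in> parcs (med_graph n)"
      using u by cases (auto simp: med_graph_def)
  qed
qed

lemma walk_matrix_med_graph:
  "walk_matrix (med_graph n) 0 v = (if v = 3 \<or> v = 4 then 1/2 else 0)"
  "walk_matrix (med_graph n) 1 v = (if v = 3 \<or> v = 6 then 1/2 else 0)"
  "walk_matrix (med_graph n) 2 v = (if v = 4 \<or> v = 6 then 1/2 else 0)"
  "walk_matrix (med_graph n) 3 v = (if v = 5 then 1 else 0)"
  "walk_matrix (med_graph n) 4 v = (if v = 5 then 1 else 0)"
  "walk_matrix (med_graph n) 5 v = (if v = 6 then 1 else 0)"
  "walk_matrix (med_graph n) 6 v = (if v = 6 then 1 else 0)"
proof -
  let ?N = "\<lambda>u. {v. (u, v) \<in> parcs (med_graph n)}"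
  have N: "?N 0 = {3,4}" "?N 1 = {3,6}" "?N 2 = {4,6}" "?N 3 = {5}" "?N 4 = {5}"
    "?N 5 = {6}" "?N 6 = {6}"
    by (auto simp: med_graph_def)
  have W: "walk_matrix (med_graph n) u v = (if v \<in> ?N u then 1 / real (card (?N u)) else 0)" for u
    by (simp add: walk_matrix_def out_degree_with_proj)
  show "walk_matrix (med_graph n) 0 v = (if v = 3 \<or> v = 4 then 1/2 else 0)"
    "walk_matrix (med_graph n) 1 v = (if v = 3 \<or> v = 6 then 1/2 else 0)"
    "walk_matrix (med_graph n) 2 v = (if v = 4 \<or> v = 6 then 1/2 else 0)"
    "walk_matrix (med_graph n) 3 v = (if v = 5 then 1 else 0)"
    "walk_matrix (med_graph n) 4 v = (if v = 5 then 1 else 0)"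
    "walk_matrix (med_graph n) 5 v = (if v = 6 then 1 else 0)"
    "walk_matrix (med_graph n) 6 v = (if v = 6 then 1 else 0)"
    unfolding W N by simp_all
qed

section \<open>The three personalized PageRanks\<close>

lemma sum_first_seven:
  fixes f :: "nat \<Rightarrow> real"
  assumes "\<And>u. 7 \<le> u \<Longrightarrow> f u = 0"
  shows "(\<Sum>u<7 + n. f u) = f 0 + f 1 + f 2 + f 3 + f 4 + f 5 + f 6"
proof -
  have "(\<Sum>u<7 + n. f u) = (\<Sum>u<7. f u)"
    using assms by (intro sum.mono_neutral_right) auto
  also have "\<dots> = f 0 + f 1 + f 2 + f 3 + f 4 + f 5 + f 6"
    by (simp add: eval_nat_numeral)
  finally show ?thesis .
qed

text \<open>Vertices from 7 on have no in-edges, so a PageRank reset at a vertex below 7 vanishes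
  there and seven entries describe it for every \<open>n\<close>.\<close>

definition seven :: "real list \<Rightarrow> nat \<Rightarrow> real" where
  "seven xs v = (if v < 7 then xs ! v else 0)"

text \<open>By uniqueness, a guessed vector only has to be checked against one balance equation per
  vertex below 7. The loop makes \<open>x 6\<close> occur on both sides of its own equation.\<close>

lemma personalized_PR_med_graph_eqI:
  assumes \<epsilon>: "0 < \<epsilon>" "\<epsilon> \<le> 1"
    and nonneg: "\<And>v. 0 \<le> x v" and supp: "\<And>v. 7 \<le> v \<Longrightarrow> x v = 0"
    and sum: "x 0 + x 1 + x 2 + x 3 + x 4 + x 5 + x 6 = 1" and c: "c < 7"
    and eqs: "x 0 = \<epsilon> * point_mass c 0" "x 1 = \<epsilon> * point_mass c 1" "x 2 = \<epsilon> * point_mass c 2"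
      "x 3 = (1 - \<epsilon>) * (x 0 / 2 + x 1 / 2) + \<epsilon> * point_mass c 3"
      "x 4 = (1 - \<epsilon>) * (x 0 / 2 + x 2 / 2) + \<epsilon> * point_mass c 4"
      "x 5 = (1 - \<epsilon>) * (x 3 + x 4) + \<epsilon> * point_mass c 5"
      "x 6 = (1 - \<epsilon>) * (x 1 / 2 + x 2 / 2 + x 5 + x 6) + \<epsilon> * point_mass c 6"
  shows "personalized_PR (med_graph n) c \<epsilon> = x"
  unfolding personalized_PR_def
proof (rule PR_eqI[OF pr_graph_med_graph \<epsilon>])
  have rv: "ranking_vector (med_graph n) x"
    using nonneg supp sum sum_first_seven[of x n] by (intro ranking_vectorI) auto
  have "x v = (1 - \<epsilon>) * (\<Sum>u<7 + n. x u * walk_matrix (med_graph n) u v) + \<epsilon> * point_mass c v" for v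
  proof -
    have S: "(\<Sum>u<7 + n. x u * walk_matrix (med_graph n) u v) =
      x 0 * (if v = 3 \<or> v = 4 then 1/2 else 0) + x 1 * (if v = 3 \<or> v = 6 then 1/2 else 0) +
      x 2 * (if v = 4 \<or> v = 6 then 1/2 else 0) + x 3 * (if v = 5 then 1 else 0) +
      x 4 * (if v = 5 then 1 else 0) + x 5 * (if v = 6 then 1 else 0) +
      x 6 * (if v = 6 then 1 else 0)" for v
      by (subst sum_first_seven) (simp_all only: supp walk_matrix_med_graph mult_zero_left)
    consider "v = 0" | "v = 1" | "v = 2" | "v = 3" | "v = 4" | "v = 5" | "v = 6" | "7 \<le> v"
      by linarith
    then show ?thesis
    proof cases
      \<comment> \<open>Both sides are zero: there are no in-edges, and \<open>c < 7\<close>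
        excludes a reset.\<close>
      case 8
      then show ?thesis using c supp by (simp add: S point_mass_def)
    qed (use eqs[symmetric] in \<open>simp_all add: S\<close>)
  qed
  then show "stationary_distribution (med_graph n) (pr_matrix (med_graph n) (point_mass c) \<epsilon>) x"
    using rv unfolding stationary_distribution_pr_matrix_iff pverts_med_graph by blast
qed

text \<open>Starting from \<open>\<epsilon>\<close> at the reset vertex, each step multiplies by
  \<open>q\<close> and splits equally among the out-edges. The entry at the sink is the mass that
  remains to reach 1.\<close>

lemma personalized_PR_med_graph:
  assumes \<epsilon>: "0 < \<epsilon>" "\<epsilon> \<le> 1" and q: "q = 1 - \<epsilon>"
  shows "personalized_PR (med_graph n) 0 \<epsilon> =
      seven [\<epsilon>, 0, 0, \<epsilon> * q / 2, \<epsilon> * q / 2, \<epsilon> * q\<^sup>2, q ^ 3]"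
    and "personalized_PR (med_graph n) 1 \<epsilon> =
      seven [0, \<epsilon>, 0, \<epsilon> * q / 2, 0, \<epsilon> * q\<^sup>2 / 2, q * (1 + q\<^sup>2) / 2]"
    and "personalized_PR (med_graph n) 2 \<epsilon> =
      seven [0, 0, \<epsilon>, 0, \<epsilon> * q / 2, \<epsilon> * q\<^sup>2 / 2, q * (1 + q\<^sup>2) / 2]"
proof -
  have e: "\<epsilon> = 1 - q" "0 \<le> q" "q \<le> 1" using assms by auto
  \<comment> \<open>With \<open>\<epsilon>\<close> replaced by \<open>1 - q\<close>, nonnegativity
    of entries like \<open>\<epsilon> * q / 2\<close> and \<open>\<epsilon> * q\<^sup>2\<close>
    reduces to these bounds.\<close>
  then have qq: "q * q \<le> q" "q * (q * q) \<le> q * q" by (auto intro: mult_left_le mult_left_le_one_le)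
  have nonneg: "0 \<le> seven xs v" if "length xs = 7" "\<forall>y\<in>set xs. 0 \<le> y" for xs v
    using that by (simp add: seven_def)
  show "personalized_PR (med_graph n) 0 \<epsilon> =
      seven [\<epsilon>, 0, 0, \<epsilon> * q / 2, \<epsilon> * q / 2, \<epsilon> * q\<^sup>2, q ^ 3]"
    by (rule personalized_PR_med_graph_eqI[OF \<epsilon>], rule nonneg)
       (use e(2,3) qq in \<open>simp_all add: e(1) seven_def point_mass_def eval_nat_numeral algebra_simps\<close>)
  show "personalized_PR (med_graph n) 1 \<epsilon> =
      seven [0, \<epsilon>, 0, \<epsilon> * q / 2, 0, \<epsilon> * q\<^sup>2 / 2, q * (1 + q\<^sup>2) / 2]"
    by (rule personalized_PR_med_graph_eqI[OF \<epsilon>], rule nonneg)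
       (use e(2,3) qq in \<open>simp_all add: e(1) seven_def point_mass_def eval_nat_numeral field_simps\<close>)
  show "personalized_PR (med_graph n) 2 \<epsilon> =
      seven [0, 0, \<epsilon>, 0, \<epsilon> * q / 2, \<epsilon> * q\<^sup>2 / 2, q * (1 + q\<^sup>2) / 2]"
    by (rule personalized_PR_med_graph_eqI[OF \<epsilon>], rule nonneg)
       (use e(2,3) qq in \<open>simp_all add: e(1) seven_def point_mass_def eval_nat_numeral field_simps\<close>)
qed

text \<open>An isomorphism is injective on vertices, so it preserves their number, here
  \<open>7 + n\<close>.\<close>

lemma med_graph_iso_imp_eq:
  assumes "digraph_iso (with_proj (med_graph m)) (with_proj (med_graph n))"
  shows "m = n"
proof -
  obtain h where h: "pre_digraph.digraph_isomorphism (with_proj (med_graph m)) h"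
    "with_proj (med_graph n) = app_iso h (with_proj (med_graph m))"
    using assms by (auto simp: digraph_iso_def)
  have "inj_on (iso_verts h) {..<7 + m}"
    using h(1) by (simp add: pre_digraph.digraph_isomorphism_def)
  moreover have "{..<7 + n} = iso_verts h ` {..<7 + m}"
    using arg_cong[OF h(2), of verts] by simp
  ultimately have "card {..<7 + n} = card {..<7 + m}" by (metis card_image)
  then show ?thesis by simp
qed

section \<open>The normalized median and the violated bound\<close>

lemma R_med_med_graph:
  fixes \<epsilon> :: real and n :: nat
  assumes \<epsilon>: "0 < \<epsilon>" "\<epsilon> < 1"
  defines "X \<equiv> (\<lambda>c. personalized_PR (med_graph n) c \<epsilon>) ` {0, 1, 2}"
  shows "l1_norm (med_graph n) (median_vec X) > 0"
    and "\<lbrakk>0 < \<eta>; \<eta> \<le> 1; R_med (med_graph n) X \<in> PR_set (med_graph n) \<eta>\<rbrakk> \<Longrightarrow> 2 * (1 - \<eta>) \<le> 1 - \<epsilon>"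
proof -
  define q where "q = 1 - \<epsilon>"
  have q: "0 < q" using \<epsilon> by (simp add: q_def)
  define x1 where "x1 = seven [\<epsilon>, 0, 0, \<epsilon> * q / 2, \<epsilon> * q / 2, \<epsilon> * q\<^sup>2, q ^ 3]"
  define x2 where "x2 = seven [0, \<epsilon>, 0, \<epsilon> * q / 2, 0, \<epsilon> * q\<^sup>2 / 2, q * (1 + q\<^sup>2) / 2]"
  define x3 where "x3 = seven [0, 0, \<epsilon>, 0, \<epsilon> * q / 2, \<epsilon> * q\<^sup>2 / 2, q * (1 + q\<^sup>2) / 2]"
  have X: "X = {x1, x2, x3}"
    unfolding X_def x1_def x2_def x3_def
    using personalized_PR_med_graph[OF \<epsilon>(1) less_imp_le[OF \<epsilon>(2)] q_def, of n] by simp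
  have vals: "x1 0 = \<epsilon>" "x2 0 = 0" "x3 0 = 0" "x2 1 = \<epsilon>" "x3 1 = 0"
    "x1 3 = \<epsilon> * q / 2" "x2 3 = \<epsilon> * q / 2" "x3 3 = 0"
    "x1 4 = \<epsilon> * q / 2" "x2 4 = 0" "x3 4 = \<epsilon> * q / 2"
    "x1 5 = \<epsilon> * q\<^sup>2" "x2 5 = \<epsilon> * q\<^sup>2 / 2" "x3 5 = \<epsilon> * q\<^sup>2 / 2"
    by (simp_all add: x1_def x2_def x3_def seven_def)
  \<comment> \<open>The entries at 0 separate \<open>x1\<close> from the other two, those at 1
    separate \<open>x2\<close> from \<open>x3\<close>.\<close>
  have ne: "x1 \<noteq> x2" "x1 \<noteq> x3" "x2 \<noteq> x3" using vals \<epsilon> by force+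
  have med: "median_vec X v = median {#x1 v, x2 v, x3 v#}" for v
    unfolding X using median_vec_three[OF ne] .
  have m3: "median_vec X 3 = \<epsilon> * q / 2"
    using median_three[of 0 "\<epsilon> * q / 2" "\<epsilon> * q / 2"] \<epsilon> q
    by (simp add: med vals add_mset_commute)
  have m4: "median_vec X 4 = \<epsilon> * q / 2"
    using median_three[of 0 "\<epsilon> * q / 2" "\<epsilon> * q / 2"] \<epsilon> q
    by (simp add: med vals add_mset_commute)
  have m5: "median_vec X 5 = \<epsilon> * q\<^sup>2 / 2"
    using median_three[of "\<epsilon> * q\<^sup>2 / 2" "\<epsilon> * q\<^sup>2 / 2" "\<epsilon> * q\<^sup>2"] \<epsilon> q
    by (simp add: med vals add_mset_commute)
  have "\<bar>median_vec X 3\<bar> \<le> l1_norm (med_graph n) (median_vec X)"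
    unfolding l1_norm_def by (rule member_le_sum) auto
  moreover have "0 < \<bar>median_vec X 3\<bar>" unfolding m3 using \<epsilon> q by simp
  ultimately show N: "l1_norm (med_graph n) (median_vec X) > 0" by linarith
  show "2 * (1 - \<eta>) \<le> 1 - \<epsilon>"
    if \<eta>: "0 < \<eta>" "\<eta> \<le> 1" and R: "R_med (med_graph n) X \<in> PR_set (med_graph n) \<eta>"
  proof -
    let ?N = "l1_norm (med_graph n) (median_vec X)"
    have "(1 - \<eta>) * (\<Sum>u\<in>{3, 4}. R_med (med_graph n) X u * walk_matrix (med_graph n) u 5)
        \<le> R_med (med_graph n) X 5"
      by (rule PR_set_lower_bound[OF pr_graph_med_graph \<eta> R]) auto
    \<comment> \<open>The arcs from 3 and 4 to 5 have weight 1, so two medians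
      \<open>\<epsilon> * q / 2\<close> add up on the left. Normalization divides both sides by the
      same positive \<open>?N\<close>, which then cancels.\<close>
    then have "(1 - \<eta>) * (\<epsilon> * q) / ?N \<le> (q / 2) * (\<epsilon> * q) / ?N"
      by (simp add: walk_matrix_med_graph R_med_def m3 m4 m5 power2_eq_square mult_ac)
    then have "(1 - \<eta>) * (\<epsilon> * q) \<le> (q / 2) * (\<epsilon> * q)"
      using N unfolding divide_le_cancel by blast
    then have "1 - \<eta> \<le> q / 2" using \<epsilon> q by (simp add: mult_le_cancel_right)
    then show ?thesis by (simp add: q_def)
  qed
qed

theorem theorem20:
  fixes \<epsilon> :: real
  assumes "0 < \<epsilon>" and "\<epsilon> < 1"
  shows "\<exists>\<G> :: nat pair_pre_digraph set.
    infinite \<G> \<and>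
    (\<forall>G\<in>\<G>. \<forall>H\<in>\<G>. G \<noteq> H \<longrightarrow> \<not> digraph_iso (with_proj G) (with_proj H)) \<and>
    (\<forall>G\<in>\<G>. pr_graph G \<and>
      (\<exists>X. finite X \<and> X \<noteq> {} \<and>
        (\<forall>x\<in>X. \<exists>c\<in>pverts G. x = personalized_PR G c \<epsilon>) \<and>
        X \<subseteq> PR_set G \<epsilon> \<and>
        l1_norm G (median_vec X) > 0 \<and>
        R_med G X \<notin> PR_set G \<epsilon> \<and>
        (\<forall>\<eta>. 0 < \<eta> \<and> \<eta> \<le> 1/2 \<longrightarrow> R_med G X \<notin> PR_set G \<eta>)))"
proof (intro exI[of _ "range med_graph"] conjI ballI)
  have "inj med_graph"
    by (rule injI, drule arg_cong[of _ _ "\<lambda>G. card (pverts G)"]) simp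
  then show "infinite (range med_graph)" by (rule range_inj_infinite)
  show "G \<noteq> H \<longrightarrow> \<not> digraph_iso (with_proj G) (with_proj H)"
    if "G \<in> range med_graph" "H \<in> range med_graph" for G H
    using that med_graph_iso_imp_eq by auto
next
  fix G assume "G \<in> range med_graph"
  then obtain n where G: "G = med_graph n" by auto
  show "pr_graph G" by (simp add: G pr_graph_med_graph)
  define X where "X = (\<lambda>c. personalized_PR G c \<epsilon>) ` {0, 1, 2}"
  have "X \<subseteq> PR_set G \<epsilon>"
    unfolding X_def PR_set_def personalized_PR_def G
    by (auto intro!: exI[of _ "point_mass _"] ranking_vector_point_mass)
  moreover have "l1_norm G (median_vec X) > 0"
    using R_med_med_graph(1)[OF assms] by (simp add: G X_def)
  moreover have bound: "2 * (1 - \<eta>) \<le> 1 - \<epsilon>" if "0 < \<eta>" "\<eta> \<le> 1" "R_med G X \<in> PR_set G \<eta>" for \<eta>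
    using R_med_med_graph(2)[OF assms that(1,2)] that(3) by (simp add: G X_def)
  \<comment> \<open>For \<open>\<eta> = \<epsilon>\<close> the bound would give
    \<open>1 - \<epsilon> \<le> 0\<close>; for \<open>\<eta> \<le> 1/2\<close> its left side is at
    least 1, above \<open>1 - \<epsilon>\<close>.\<close>
  have "R_med G X \<notin> PR_set G \<epsilon>"
    using bound[of \<epsilon>] assms by auto
  moreover have "R_med G X \<notin> PR_set G \<eta>" if "0 < \<eta>" "\<eta> \<le> 1/2" for \<eta>
    using bound[of \<eta>] assms that by auto
  moreover have "finite X" "X \<noteq> {}" "\<forall>x\<in>X. \<exists>c\<in>pverts G. x = personalized_PR G c \<epsilon>"
    by (auto simp: X_def G)
  ultimately show "\<exists>X. finite X \<and> X \<noteq> {} \<and>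
        (\<forall>x\<in>X. \<exists>c\<in>pverts G. x = personalized_PR G c \<epsilon>) \<and>
        X \<subseteq> PR_set G \<epsilon> \<and>
        l1_norm G (median_vec X) > 0 \<and>
        R_med G X \<notin> PR_set G \<epsilon> \<and>
        (\<forall>\<eta>. 0 < \<eta> \<and> \<eta> \<le> 1/2 \<longrightarrow> R_med G X \<notin> PR_set G \<eta>)"
    by (intro exI[of _ X]) blast
qed

end
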